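(* Let $S$ be a $\Gamma$-semigroup with unities, let $R$ be its right operator semigroup, and let $Q$ be any non-empty set. If $\sigma$ is a $Q$-fuzzy ideal (respectively $Q$-fuzzy left ideal) of $S$, then $\sigma^{*'}$ is a $Q$-fuzzy ideal (respectively $Q$-fuzzy left ideal) of $R$.
   Context: $\Gamma$-semigroup: non-empty sets $S$ and $\Gamma$ together with mappings $S\times\Gamma\times S\to S$, $(a,\alpha,b)\mapsto a\alpha b$, and $\Gamma\times S\times\Gamma\to\Gamma$, $(\alpha,a,\beta)\mapsto\alpha a\beta$, such that $(a\alpha b)\beta c=a(\alpha b\beta)c=a\alpha(b\beta c)$ and $\alpha(a\beta b)\gamma=(\alpha a\beta)b\gamma=\alpha a(\beta b\gamma)$ for all $a,b,c\in S$ and $\alpha,\beta,\gamma\in\Gamma$; one says $S$ is a $\Gamma$-semigroup. Operator semigroups: on $S\times\Gamma$ define the equivalence relation $(x,\alpha)\rho(y,\beta)$ iff $x\alpha s=y\beta s$ for all $s\in S$ and $\gamma x\alpha=\gamma y\beta$ for all $\gamma\in\Gamma$; write $[x,\alpha]$ for the class of $(x,\alpha)$. The left operator semigroup is $L=\{[x,\alpha]:x\in S,\alpha\in\Gamma\}$ with multiplication $[x,\alpha][y,\beta]=[x\alpha y,\beta]$. Dually, the right operator semigroup $R$ consists of the classes $[\alpha,a]$ of pairs in $\Gamma\times S$ under the relation $(\alpha,a)\sim(\beta,b)$ iff $s\alpha a=s\beta b$ for all $s\in S$ and $\alpha a\gamma=\beta b\gamma$ for all $\gamma\in\Gamma$,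 with multiplication $[\alpha,a][\beta,b]=[\alpha a\beta,b]$. A left unity of $S$ is an element $[e,\delta]\in L$ with $e\delta s=s$ for all $s\in S$; a right unity of $S$ is an element $[\gamma,f]\in R$ with $s\gamma f=s$ for all $s\in S$. "$S$ with unities" means that $S$ has a left unity and a right unity. A $Q$-fuzzy subset of a non-empty set $X$ is a function $\mu:X\times Q\to[0,1]$; it is non-empty if it is not identically $0$. A non-empty $Q$-fuzzy subset $\mu$ of $S$ is a $Q$-fuzzy left (right) ideal of $S$ if $\mu(x\gamma y,q)\ge\mu(y,q)$ (respectively $\ge\mu(x,q)$) for all $x,y\in S,\gamma\in\Gamma,q\in Q$, and a $Q$-fuzzy ideal if it is both. For a semigroup $T$ (such as $R$), a non-empty $Q$-fuzzy subset $\mu$ of $T$ is a $Q$-fuzzy left (right) ideal of $T$ if $\mu(xy,q)\ge\mu(y,q)$ (respectively $\ge\mu(x,q)$) for all $x,y\in T,q\in Q$, and a $Q$-fuzzy ideal if it is both. For a $Q$-fuzzy subset $\sigma$ of $S$, the $Q$-fuzzy subset $\sigma^{*'}$ of $R$ is $\sigma^{*'}([\alpha,a],q)=\inf_{s\in S}\sigma(s\alpha a,q)$. *)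

theory Defs
  imports Complex_Main "HOL-Library.FuncSet"
begin

text \<open>
  \<open>Gam\<close> is the set \<open>\<Gamma>\<close>; \<open>ms a \<alpha> b\<close> is the product \<open>a\<alpha>b \<in> S\<close> and \<open>mg \<alpha> a \<beta>\<close> is the product
  \<open>\<alpha>a\<beta> \<in> \<Gamma>\<close>. All structures live on explicit carrier sets, and only the values of functions on
  these carriers matter.
\<close>

locale gamma_semigroup =
  fixes S :: "'a set" and Gam :: "'g set"
    and ms :: "'a \<Rightarrow> 'g \<Rightarrow> 'a \<Rightarrow> 'a" and mg :: "'g \<Rightarrow> 'a \<Rightarrow> 'g \<Rightarrow> 'g"
  assumes S_nonempty: "S \<noteq> {}"
    and Gam_nonempty: "Gam \<noteq> {}"
    and ms_closed: "\<lbrakk>a \<in> S; \<alpha> \<in> Gam; b \<in> S\<rbrakk> \<Longrightarrow> ms a \<alpha> b \<in> S"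
    and mg_closed: "\<lbrakk>\<alpha> \<in> Gam; a \<in> S; \<beta> \<in> Gam\<rbrakk> \<Longrightarrow> mg \<alpha> a \<beta> \<in> Gam"
    and ms_assoc:
      "\<lbrakk>a \<in> S; b \<in> S; c \<in> S; \<alpha> \<in> Gam; \<beta> \<in> Gam\<rbrakk> \<Longrightarrow> ms (ms a \<alpha> b) \<beta> c = ms a (mg \<alpha> b \<beta>) c"
      "\<lbrakk>a \<in> S; b \<in> S; c \<in> S; \<alpha> \<in> Gam; \<beta> \<in> Gam\<rbrakk> \<Longrightarrow> ms a (mg \<alpha> b \<beta>) c = ms a \<alpha> (ms b \<beta> c)"
    and mg_assoc:
      "\<lbrakk>a \<in> S; b \<in> S; \<alpha> \<in> Gam; \<beta> \<in> Gam; \<gamma> \<in> Gam\<rbrakk> \<Longrightarrow> mg \<alpha> (ms a \<beta> b) \<gamma> = mg (mg \<alpha> a \<beta>) b \<gamma>"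
      "\<lbrakk>a \<in> S; b \<in> S; \<alpha> \<in> Gam; \<beta> \<in> Gam; \<gamma> \<in> Gam\<rbrakk> \<Longrightarrow> mg (mg \<alpha> a \<beta>) b \<gamma> = mg \<alpha> a (mg \<beta> b \<gamma>)"

locale semigroup_on =
  fixes T :: "'t set" and mult :: "'t \<Rightarrow> 't \<Rightarrow> 't"
  assumes closed: "\<lbrakk>x \<in> T; y \<in> T\<rbrakk> \<Longrightarrow> mult x y \<in> T"
    and assoc: "\<lbrakk>x \<in> T; y \<in> T; z \<in> T\<rbrakk> \<Longrightarrow> mult (mult x y) z = mult x (mult y z)"


subsection \<open>Operator semigroups and unities\<close>

definition left_op_rel ::
    "'a set \<Rightarrow> 'g set \<Rightarrow> ('a \<Rightarrow> 'g \<Rightarrow> 'a \<Rightarrow> 'a) \<Rightarrow> ('g \<Rightarrow> 'a \<Rightarrow> 'g \<Rightarrow> 'g) \<Rightarrow> (('a \<times> 'g) \<times> ('a \<times> 'g)) set"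
  where "left_op_rel S Gam ms mg =
    {((x, \<alpha>), (y, \<beta>)). x \<in> S \<and> \<alpha> \<in> Gam \<and> y \<in> S \<and> \<beta> \<in> Gam \<and>
       (\<forall>s\<in>S. ms x \<alpha> s = ms y \<beta> s) \<and> (\<forall>\<gamma>\<in>Gam. mg \<gamma> x \<alpha> = mg \<gamma> y \<beta>)}"

definition right_op_rel ::
    "'a set \<Rightarrow> 'g set \<Rightarrow> ('a \<Rightarrow> 'g \<Rightarrow> 'a \<Rightarrow> 'a) \<Rightarrow> ('g \<Rightarrow> 'a \<Rightarrow> 'g \<Rightarrow> 'g) \<Rightarrow> (('g \<times> 'a) \<times> ('g \<times> 'a)) set"
  where "right_op_rel S Gam ms mg =
    {((\<alpha>, a), (\<beta>, b)). \<alpha> \<in> Gam \<and> a \<in> S \<and> \<beta> \<in> Gam \<and> b \<in> S \<and>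
       (\<forall>s\<in>S. ms s \<alpha> a = ms s \<beta> b) \<and> (\<forall>\<gamma>\<in>Gam. mg \<alpha> a \<gamma> = mg \<beta> b \<gamma>)}"

definition left_op ::
    "'a set \<Rightarrow> 'g set \<Rightarrow> ('a \<Rightarrow> 'g \<Rightarrow> 'a \<Rightarrow> 'a) \<Rightarrow> ('g \<Rightarrow> 'a \<Rightarrow> 'g \<Rightarrow> 'g) \<Rightarrow> ('a \<times> 'g) set set"
  where "left_op S Gam ms mg = (S \<times> Gam) // left_op_rel S Gam ms mg"

definition right_op ::
    "'a set \<Rightarrow> 'g set \<Rightarrow> ('a \<Rightarrow> 'g \<Rightarrow> 'a \<Rightarrow> 'a) \<Rightarrow> ('g \<Rightarrow> 'a \<Rightarrow> 'g \<Rightarrow> 'g) \<Rightarrow> ('g \<times> 'a) set set"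
  where "right_op S Gam ms mg = (Gam \<times> S) // right_op_rel S Gam ms mg"

text \<open>
  The products on classes are unions over all choices of representatives; see
  \<open>left_op_mult_class\<close> and \<open>right_op_mult_class\<close> below.
\<close>

definition left_op_mult ::
    "'a set \<Rightarrow> 'g set \<Rightarrow> ('a \<Rightarrow> 'g \<Rightarrow> 'a \<Rightarrow> 'a) \<Rightarrow> ('g \<Rightarrow> 'a \<Rightarrow> 'g \<Rightarrow> 'g) \<Rightarrow>
     ('a \<times> 'g) set \<Rightarrow> ('a \<times> 'g) set \<Rightarrow> ('a \<times> 'g) set"
  where "left_op_mult S Gam ms mg U V =
    (\<Union>(x, \<alpha>)\<in>U. \<Union>(y, \<beta>)\<in>V. left_op_rel S Gam ms mg `` {(ms x \<alpha> y, \<beta>)})"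

definition right_op_mult ::
    "'a set \<Rightarrow> 'g set \<Rightarrow> ('a \<Rightarrow> 'g \<Rightarrow> 'a \<Rightarrow> 'a) \<Rightarrow> ('g \<Rightarrow> 'a \<Rightarrow> 'g \<Rightarrow> 'g) \<Rightarrow>
     ('g \<times> 'a) set \<Rightarrow> ('g \<times> 'a) set \<Rightarrow> ('g \<times> 'a) set"
  where "right_op_mult S Gam ms mg U V =
    (\<Union>(\<alpha>, a)\<in>U. \<Union>(\<beta>, b)\<in>V. right_op_rel S Gam ms mg `` {(mg \<alpha> a \<beta>, b)})"

definition left_unity ::
    "'a set \<Rightarrow> 'g set \<Rightarrow> ('a \<Rightarrow> 'g \<Rightarrow> 'a \<Rightarrow> 'a) \<Rightarrow> ('g \<Rightarrow> 'a \<Rightarrow> 'g \<Rightarrow> 'g) \<Rightarrow> ('a \<times> 'g) set \<Rightarrow> bool"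
  where "left_unity S Gam ms mg u \<longleftrightarrow> u \<in> left_op S Gam ms mg \<and>
    (\<exists>e\<in>S. \<exists>\<delta>\<in>Gam. u = left_op_rel S Gam ms mg `` {(e, \<delta>)} \<and> (\<forall>s\<in>S. ms e \<delta> s = s))"

definition right_unity ::
    "'a set \<Rightarrow> 'g set \<Rightarrow> ('a \<Rightarrow> 'g \<Rightarrow> 'a \<Rightarrow> 'a) \<Rightarrow> ('g \<Rightarrow> 'a \<Rightarrow> 'g \<Rightarrow> 'g) \<Rightarrow> ('g \<times> 'a) set \<Rightarrow> bool"
  where "right_unity S Gam ms mg u \<longleftrightarrow> u \<in> right_op S Gam ms mg \<and>
    (\<exists>\<gamma>\<in>Gam. \<exists>f\<in>S. u = right_op_rel S Gam ms mg `` {(\<gamma>, f)} \<and> (\<forall>s\<in>S. ms s \<gamma> f = s))"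

locale gamma_semigroup_with_unities = gamma_semigroup S Gam ms mg
  for S :: "'a set" and Gam :: "'g set"
    and ms :: "'a \<Rightarrow> 'g \<Rightarrow> 'a \<Rightarrow> 'a" and mg :: "'g \<Rightarrow> 'a \<Rightarrow> 'g \<Rightarrow> 'g" +
  assumes left_unity_exists: "\<exists>u. left_unity S Gam ms mg u"
    and right_unity_exists: "\<exists>u. right_unity S Gam ms mg u"


subsection \<open>\<open>Q\<close>-fuzzy subsets and ideals\<close>

definition Q_fuzzy_subset :: "'x set \<Rightarrow> 'q set \<Rightarrow> ('x \<times> 'q \<Rightarrow> real) \<Rightarrow> bool"
  where "Q_fuzzy_subset X Q \<mu> \<longleftrightarrow> \<mu> \<in> X \<times> Q \<rightarrow> {0..1}"

definition Q_fuzzy_nonempty :: "'x set \<Rightarrow> 'q set \<Rightarrow> ('x \<times> 'q \<Rightarrow> real) \<Rightarrow> bool"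
  where "Q_fuzzy_nonempty X Q \<mu> \<longleftrightarrow> (\<exists>p \<in> X \<times> Q. \<mu> p \<noteq> 0)"

definition gamma_Q_fuzzy_left_ideal ::
    "'a set \<Rightarrow> 'g set \<Rightarrow> ('a \<Rightarrow> 'g \<Rightarrow> 'a \<Rightarrow> 'a) \<Rightarrow> 'q set \<Rightarrow> ('a \<times> 'q \<Rightarrow> real) \<Rightarrow> bool"
  where "gamma_Q_fuzzy_left_ideal S Gam ms Q \<mu> \<longleftrightarrow>
    Q_fuzzy_subset S Q \<mu> \<and> Q_fuzzy_nonempty S Q \<mu> \<and>
    (\<forall>x\<in>S. \<forall>y\<in>S. \<forall>\<gamma>\<in>Gam. \<forall>q\<in>Q. \<mu> (ms x \<gamma> y, q) \<ge> \<mu> (y, q))"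

definition gamma_Q_fuzzy_right_ideal ::
    "'a set \<Rightarrow> 'g set \<Rightarrow> ('a \<Rightarrow> 'g \<Rightarrow> 'a \<Rightarrow> 'a) \<Rightarrow> 'q set \<Rightarrow> ('a \<times> 'q \<Rightarrow> real) \<Rightarrow> bool"
  where "gamma_Q_fuzzy_right_ideal S Gam ms Q \<mu> \<longleftrightarrow>
    Q_fuzzy_subset S Q \<mu> \<and> Q_fuzzy_nonempty S Q \<mu> \<and>
    (\<forall>x\<in>S. \<forall>y\<in>S. \<forall>\<gamma>\<in>Gam. \<forall>q\<in>Q. \<mu> (ms x \<gamma> y, q) \<ge> \<mu> (x, q))"

definition gamma_Q_fuzzy_ideal ::
    "'a set \<Rightarrow> 'g set \<Rightarrow> ('a \<Rightarrow> 'g \<Rightarrow> 'a \<Rightarrow> 'a) \<Rightarrow> 'q set \<Rightarrow> ('a \<times> 'q \<Rightarrow> real) \<Rightarrow> bool"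
  where "gamma_Q_fuzzy_ideal S Gam ms Q \<mu> \<longleftrightarrow>
    gamma_Q_fuzzy_left_ideal S Gam ms Q \<mu> \<and> gamma_Q_fuzzy_right_ideal S Gam ms Q \<mu>"

definition Q_fuzzy_left_ideal ::
    "'t set \<Rightarrow> ('t \<Rightarrow> 't \<Rightarrow> 't) \<Rightarrow> 'q set \<Rightarrow> ('t \<times> 'q \<Rightarrow> real) \<Rightarrow> bool"
  where "Q_fuzzy_left_ideal T mult Q \<mu> \<longleftrightarrow>
    Q_fuzzy_subset T Q \<mu> \<and> Q_fuzzy_nonempty T Q \<mu> \<and>
    (\<forall>x\<in>T. \<forall>y\<in>T. \<forall>q\<in>Q. \<mu> (mult x y, q) \<ge> \<mu> (y, q))"

definition Q_fuzzy_right_ideal ::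
    "'t set \<Rightarrow> ('t \<Rightarrow> 't \<Rightarrow> 't) \<Rightarrow> 'q set \<Rightarrow> ('t \<times> 'q \<Rightarrow> real) \<Rightarrow> bool"
  where "Q_fuzzy_right_ideal T mult Q \<mu> \<longleftrightarrow>
    Q_fuzzy_subset T Q \<mu> \<and> Q_fuzzy_nonempty T Q \<mu> \<and>
    (\<forall>x\<in>T. \<forall>y\<in>T. \<forall>q\<in>Q. \<mu> (mult x y, q) \<ge> \<mu> (x, q))"

definition Q_fuzzy_ideal ::
    "'t set \<Rightarrow> ('t \<Rightarrow> 't \<Rightarrow> 't) \<Rightarrow> 'q set \<Rightarrow> ('t \<times> 'q \<Rightarrow> real) \<Rightarrow> bool"
  where "Q_fuzzy_ideal T mult Q \<mu> \<longleftrightarrow>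
    Q_fuzzy_left_ideal T mult Q \<mu> \<and> Q_fuzzy_right_ideal T mult Q \<mu>"

text \<open>
  The infimum is the same for all representatives \<open>(\<alpha>, a)\<close> of a class, so the image of the class
  is a singleton; see \<open>star_prime_class\<close> below.
\<close>

definition star_prime ::
    "'a set \<Rightarrow> ('a \<Rightarrow> 'g \<Rightarrow> 'a \<Rightarrow> 'a) \<Rightarrow> ('a \<times> 'q \<Rightarrow> real) \<Rightarrow> ('g \<times> 'a) set \<times> 'q \<Rightarrow> real"
  where "star_prime S ms \<sigma> = (\<lambda>(r, q). the_elem ((\<lambda>(\<alpha>, a). INF s\<in>S. \<sigma> (ms s \<alpha> a, q)) ` r))"


subsection \<open>Well-definedness\<close>

context gamma_semigroup
begin

lemma equiv_left_op_rel: "equiv (S \<times> Gam) (left_op_rel S Gam ms mg)"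
  by (rule equivI) (auto simp: left_op_rel_def refl_on_def sym_def trans_def)

lemma equiv_right_op_rel: "equiv (Gam \<times> S) (right_op_rel S Gam ms mg)"
  by (rule equivI) (auto simp: right_op_rel_def refl_on_def sym_def trans_def)

lemma left_op_mult_class:
  assumes "x \<in> S" "\<alpha> \<in> Gam" "y \<in> S" "\<beta> \<in> Gam"
  shows "left_op_mult S Gam ms mg (left_op_rel S Gam ms mg `` {(x, \<alpha>)}) (left_op_rel S Gam ms mg `` {(y, \<beta>)})
    = left_op_rel S Gam ms mg `` {(ms x \<alpha> y, \<beta>)}"
proof -
  let ?r = "left_op_rel S Gam ms mg"
  have self: "(x, \<alpha>) \<in> ?r `` {(x, \<alpha>)}" "(y, \<beta>) \<in> ?r `` {(y, \<beta>)}"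
    using assms by (auto simp: left_op_rel_def)
  have "?r `` {(ms x' \<alpha>' y', \<beta>')} = ?r `` {(ms x \<alpha> y, \<beta>)}"
    if "((x, \<alpha>), (x', \<alpha>')) \<in> ?r" "((y, \<beta>), (y', \<beta>')) \<in> ?r" for x' \<alpha>' y' \<beta>'
  proof (rule equiv_class_eq[OF equiv_left_op_rel])
    show "((ms x' \<alpha>' y', \<beta>'), (ms x \<alpha> y, \<beta>)) \<in> ?r"
      using that by (auto simp: left_op_rel_def ms_closed mg_closed ms_assoc mg_assoc)
  qed
  with self show ?thesis unfolding left_op_mult_def by fast
qed

lemma right_op_mult_class:
  assumes "\<alpha> \<in> Gam" "a \<in> S" "\<beta> \<in> Gam" "b \<in> S"
  shows "right_op_mult S Gam ms mg (right_op_rel S Gam ms mg `` {(\<alpha>, a)}) (right_op_rel S Gam ms mg `` {(\<beta>, b)})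
    = right_op_rel S Gam ms mg `` {(mg \<alpha> a \<beta>, b)}"
proof -
  let ?r = "right_op_rel S Gam ms mg"
  have self: "(\<alpha>, a) \<in> ?r `` {(\<alpha>, a)}" "(\<beta>, b) \<in> ?r `` {(\<beta>, b)}"
    using assms by (auto simp: right_op_rel_def)
  have "?r `` {(mg \<alpha>' a' \<beta>', b')} = ?r `` {(mg \<alpha> a \<beta>, b)}"
    if "((\<alpha>, a), (\<alpha>', a')) \<in> ?r" "((\<beta>, b), (\<beta>', b')) \<in> ?r" for \<alpha>' a' \<beta>' b'
  proof (rule equiv_class_eq[OF equiv_right_op_rel])
    show "((mg \<alpha>' a' \<beta>', b'), (mg \<alpha> a \<beta>, b)) \<in> ?r"
      using that by (auto simp: right_op_rel_def ms_closed mg_closed mg_assoc ms_assoc(1)[symmetric])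
  qed
  with self show ?thesis unfolding right_op_mult_def by fast
qed

lemma semigroup_on_left_op: "semigroup_on (left_op S Gam ms mg) (left_op_mult S Gam ms mg)"
  by unfold_locales
    (auto simp: left_op_def left_op_mult_class ms_closed mg_closed ms_assoc
      intro!: quotientI elim!: quotientE)

lemma semigroup_on_right_op: "semigroup_on (right_op S Gam ms mg) (right_op_mult S Gam ms mg)"
  by unfold_locales
    (auto simp: right_op_def right_op_mult_class ms_closed mg_closed mg_assoc
      intro!: quotientI elim!: quotientE)

lemma star_prime_class:
  assumes "\<alpha> \<in> Gam" "a \<in> S"
  shows "star_prime S ms \<sigma> (right_op_rel S Gam ms mg `` {(\<alpha>, a)}, q) = (INF s\<in>S. \<sigma> (ms s \<alpha> a, q))"
proof -
  let ?c = "right_op_rel S Gam ms mg `` {(\<alpha>, a)}"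
  let ?f = "\<lambda>(\<alpha>, a). INF s\<in>S. \<sigma> (ms s \<alpha> a, q)"
  have self: "(\<alpha>, a) \<in> ?c"
    using assms by (auto simp: right_op_rel_def)
  have "?f p = ?f (\<alpha>, a)" if "p \<in> ?c" for p
    using that by (auto simp: right_op_rel_def intro!: INF_cong)
  with self have "?f ` ?c = {?f (\<alpha>, a)}" by blast
  then show ?thesis by (simp add: star_prime_def)
qed

end

end

theory Submission
  imports Defs
begin

text \<open>
  Both ideal inequalities follow from \<open>s(\<alpha>a\<beta>)b = (s\<alpha>a)\<beta>b\<close>. The non-emptiness comes from
  \<open>\<sigma>(s\<alpha>a, q) \<ge> \<sigma>(a, q)\<close>: the value of \<open>\<sigma>\<^sup>*\<^sup>'\<close> at \<open>([\<alpha>, a], q)\<close> is at least \<open>\<sigma>(a, q)\<close>.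
\<close>

context gamma_semigroup
begin

lemma right_op_cases:
  assumes "r \<in> right_op S Gam ms mg"
  obtains \<alpha> a where "\<alpha> \<in> Gam" "a \<in> S" "r = right_op_rel S Gam ms mg `` {(\<alpha>, a)}"
  using assms by (auto simp: right_op_def elim!: quotientE)

text \<open>A common lower bound of a family lies below its infimum; over the reals this requires
  the family to be non-empty, which \<open>S_nonempty\<close> provides. With
  \<open>star_prime_class_le\<close> it lets the later arguments compare single values of
  \<open>\<sigma>\<close> only.\<close>

lemma star_prime_class_ge:
  assumes "\<alpha> \<in> Gam" "a \<in> S" "\<And>s. s \<in> S \<Longrightarrow> c \<le> \<sigma> (ms s \<alpha> a, q)"
  shows "c \<le> star_prime S ms \<sigma> (right_op_rel S Gam ms mg `` {(\<alpha>, a)}, q)"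
  using assms S_nonempty by (simp add: star_prime_class cINF_greatest)

text \<open>A real infimum lies below each member only if the family is bounded below. The bound 0
  comes from \<open>\<sigma>\<close> taking values in [0,1].\<close>

lemma star_prime_class_le:
  assumes "Q_fuzzy_subset S Q \<sigma>" "\<alpha> \<in> Gam" "a \<in> S" "s \<in> S" "q \<in> Q"
  shows "star_prime S ms \<sigma> (right_op_rel S Gam ms mg `` {(\<alpha>, a)}, q) \<le> \<sigma> (ms s \<alpha> a, q)"
proof -
  have "bdd_below ((\<lambda>s. \<sigma> (ms s \<alpha> a, q)) ` S)"
    using assms by (intro bdd_belowI[of _ 0]) (auto simp: Q_fuzzy_subset_def Pi_iff ms_closed)
  then show ?thesis
    using assms by (simp add: star_prime_class cINF_lower[of "\<lambda>s. \<sigma> (ms s \<alpha> a, q)"])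
qed

lemma Q_fuzzy_subset_star_prime:
  assumes "Q_fuzzy_subset S Q \<sigma>"
  shows "Q_fuzzy_subset (right_op S Gam ms mg) Q (star_prime S ms \<sigma>)"
proof -
  have "star_prime S ms \<sigma> (r, q) \<in> {0..1}" if "r \<in> right_op S Gam ms mg" "q \<in> Q" for r q
  proof -
    from that(1) obtain \<alpha> a where r: "\<alpha> \<in> Gam" "a \<in> S" "r = right_op_rel S Gam ms mg `` {(\<alpha>, a)}"
      by (rule right_op_cases)
    have bounds: "0 \<le> \<sigma> (ms s \<alpha> a, q)" "\<sigma> (ms s \<alpha> a, q) \<le> 1" if "s \<in> S" for s
      using assms r \<open>q \<in> Q\<close> that by (auto simp: Q_fuzzy_subset_def Pi_iff ms_closed)
    \<comment> \<open>For the upper bound 1 a single member of the family is enough.\<close>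
    obtain s where "s \<in> S" using S_nonempty by blast
    have "star_prime S ms \<sigma> (r, q) \<le> 1"
      using star_prime_class_le[OF assms r(1,2) \<open>s \<in> S\<close> \<open>q \<in> Q\<close>] bounds(2)[OF \<open>s \<in> S\<close>] r(3)
      by simp
    moreover have "0 \<le> star_prime S ms \<sigma> (r, q)"
      using r bounds(1) by (simp add: star_prime_class_ge)
    ultimately show ?thesis by simp
  qed
  then show ?thesis by (auto simp: Q_fuzzy_subset_def)
qed

text \<open>For the inequality, the values whose infimum is taken at the product class all occur
  among those for the right factor, and an infimum over fewer values can only grow.\<close>

lemma Q_fuzzy_left_ideal_star_prime:
  assumes "gamma_Q_fuzzy_left_ideal S Gam ms Q \<sigma>"
  shows "Q_fuzzy_left_ideal (right_op S Gam ms mg) (right_op_mult S Gam ms mg) Q (star_prime S ms \<sigma>)"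
proof -
  from assms have sub: "Q_fuzzy_subset S Q \<sigma>" and ne: "Q_fuzzy_nonempty S Q \<sigma>"
    and ideal: "\<And>x y \<gamma> q. \<lbrakk>x \<in> S; y \<in> S; \<gamma> \<in> Gam; q \<in> Q\<rbrakk> \<Longrightarrow> \<sigma> (y, q) \<le> \<sigma> (ms x \<gamma> y, q)"
    by (auto simp: gamma_Q_fuzzy_left_ideal_def)
  have "Q_fuzzy_nonempty (right_op S Gam ms mg) Q (star_prime S ms \<sigma>)"
  proof -
    from ne obtain a q where a: "a \<in> S" "q \<in> Q" "\<sigma> (a, q) \<noteq> 0"
      by (auto simp: Q_fuzzy_nonempty_def)
    \<comment> \<open>Being nonzero need not survive passing to a larger number, but being positive
      does.\<close>
    then have pos: "0 < \<sigma> (a, q)"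
      using sub by (force simp: Q_fuzzy_subset_def Pi_iff)
    obtain \<alpha> where \<alpha>: "\<alpha> \<in> Gam" using Gam_nonempty by blast
    let ?r = "right_op_rel S Gam ms mg `` {(\<alpha>, a)}"
    have "\<sigma> (a, q) \<le> star_prime S ms \<sigma> (?r, q)"
      using a \<alpha> ideal by (intro star_prime_class_ge) auto
    moreover have "?r \<in> right_op S Gam ms mg"
      using a \<alpha> by (auto simp: right_op_def intro: quotientI)
    ultimately show ?thesis
      using pos a unfolding Q_fuzzy_nonempty_def by (intro bexI[of _ "(?r, q)"]) auto
  qed
  moreover have "star_prime S ms \<sigma> (r', q) \<le> star_prime S ms \<sigma> (right_op_mult S Gam ms mg r r', q)"
    if r: "r \<in> right_op S Gam ms mg" and r': "r' \<in> right_op S Gam ms mg" and q: "q \<in> Q" for r r' q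
  proof -
    from r obtain \<alpha> a where \<alpha>: "\<alpha> \<in> Gam" "a \<in> S" "r = right_op_rel S Gam ms mg `` {(\<alpha>, a)}"
      by (rule right_op_cases)
    from r' obtain \<beta> b where \<beta>: "\<beta> \<in> Gam" "b \<in> S" "r' = right_op_rel S Gam ms mg `` {(\<beta>, b)}"
      by (rule right_op_cases)
    have "star_prime S ms \<sigma> (r', q) \<le> \<sigma> (ms s (mg \<alpha> a \<beta>) b, q)" if "s \<in> S" for s
      \<comment> \<open>The element of \<open>S\<close> chosen in the infimum for \<open>r'\<close>
        is \<open>s\<alpha>a\<close>; associativity turns \<open>(s\<alpha>a)\<beta>b\<close> into
        \<open>s(\<alpha>a\<beta>)b\<close>.\<close>
      using star_prime_class_le[OF sub \<beta>(1,2) ms_closed[OF that \<alpha>(1,2)] q] that \<alpha> \<beta>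
      by (simp add: ms_assoc(1))
    \<comment> \<open>The product class is represented by \<open>(\<alpha>a\<beta>, b)\<close>, so a
      bound valid for every \<open>s\<close> passes to its infimum.\<close>
    then show ?thesis
      using \<alpha> \<beta> by (simp add: right_op_mult_class star_prime_class_ge mg_closed)
  qed
  ultimately show ?thesis
    using Q_fuzzy_subset_star_prime[OF sub] by (simp add: Q_fuzzy_left_ideal_def)
qed

text \<open>Here the two families are compared term by term at the same \<open>s\<close>:
  multiplying \<open>s\<alpha>a\<close> on the right by \<open>\<beta>b\<close> does not decrease
  \<open>\<sigma>\<close>.\<close>

lemma star_prime_right_op_mult_ge_left:
  assumes "gamma_Q_fuzzy_right_ideal S Gam ms Q \<sigma>"
    and r: "r \<in> right_op S Gam ms mg" and r': "r' \<in> right_op S Gam ms mg" and q: "q \<in> Q"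
  shows "star_prime S ms \<sigma> (r, q) \<le> star_prime S ms \<sigma> (right_op_mult S Gam ms mg r r', q)"
proof -
  from assms(1) have sub: "Q_fuzzy_subset S Q \<sigma>"
    and ideal: "\<And>x y \<gamma> q. \<lbrakk>x \<in> S; y \<in> S; \<gamma> \<in> Gam; q \<in> Q\<rbrakk> \<Longrightarrow> \<sigma> (x, q) \<le> \<sigma> (ms x \<gamma> y, q)"
    by (auto simp: gamma_Q_fuzzy_right_ideal_def)
  from r obtain \<alpha> a where \<alpha>: "\<alpha> \<in> Gam" "a \<in> S" "r = right_op_rel S Gam ms mg `` {(\<alpha>, a)}"
    by (rule right_op_cases)
  from r' obtain \<beta> b where \<beta>: "\<beta> \<in> Gam" "b \<in> S" "r' = right_op_rel S Gam ms mg `` {(\<beta>, b)}"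
    by (rule right_op_cases)
  have "star_prime S ms \<sigma> (r, q) \<le> \<sigma> (ms s (mg \<alpha> a \<beta>) b, q)" if "s \<in> S" for s
  proof -
    have "star_prime S ms \<sigma> (r, q) \<le> \<sigma> (ms s \<alpha> a, q)"
      using star_prime_class_le[OF sub \<alpha>(1,2) that q] \<alpha>(3) by simp
    also have "\<dots> \<le> \<sigma> (ms (ms s \<alpha> a) \<beta> b, q)"
      using that \<alpha> \<beta> q by (intro ideal ms_closed)
    also have "\<dots> = \<sigma> (ms s (mg \<alpha> a \<beta>) b, q)"
      using that \<alpha> \<beta> by (simp add: ms_assoc(1))
    finally show ?thesis .
  qed
  then show ?thesis
    using \<alpha> \<beta> by (simp add: right_op_mult_class star_prime_class_ge mg_closed)
qed

lemma Q_fuzzy_ideal_star_prime: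
  assumes "gamma_Q_fuzzy_ideal S Gam ms Q \<sigma>"
  shows "Q_fuzzy_ideal (right_op S Gam ms mg) (right_op_mult S Gam ms mg) Q (star_prime S ms \<sigma>)"
proof -
  from assms have left: "gamma_Q_fuzzy_left_ideal S Gam ms Q \<sigma>"
    and right: "gamma_Q_fuzzy_right_ideal S Gam ms Q \<sigma>"
    by (simp_all add: gamma_Q_fuzzy_ideal_def)
  \<comment> \<open>The range and non-emptiness conditions are common to left and right ideals, so
    the left case supplies them for both.\<close>
  from Q_fuzzy_left_ideal_star_prime[OF left] star_prime_right_op_mult_ge_left[OF right]
  show ?thesis
    by (simp add: Q_fuzzy_ideal_def Q_fuzzy_left_ideal_def Q_fuzzy_right_ideal_def)
qed

end

theorem proposition5p10:
  fixes S :: "'a set" and Gam :: "'g set" and Q :: "'q set"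
    and ms :: "'a \<Rightarrow> 'g \<Rightarrow> 'a \<Rightarrow> 'a" and mg :: "'g \<Rightarrow> 'a \<Rightarrow> 'g \<Rightarrow> 'g"
    and \<sigma> :: "'a \<times> 'q \<Rightarrow> real"
  assumes "gamma_semigroup_with_unities S Gam ms mg"
    and "Q \<noteq> {}"
  shows "(gamma_Q_fuzzy_ideal S Gam ms Q \<sigma> \<longrightarrow>
            Q_fuzzy_ideal (right_op S Gam ms mg) (right_op_mult S Gam ms mg) Q (star_prime S ms \<sigma>)) \<and>
         (gamma_Q_fuzzy_left_ideal S Gam ms Q \<sigma> \<longrightarrow>
            Q_fuzzy_left_ideal (right_op S Gam ms mg) (right_op_mult S Gam ms mg) Q (star_prime S ms \<sigma>))"
proof -
  interpret gamma_semigroup_with_unities S Gam ms mg by fact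
  show ?thesis
    by (simp add: Q_fuzzy_ideal_star_prime Q_fuzzy_left_ideal_star_prime)
qed

end
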